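(* Let $X$ be a nonempty set and let $R$ be a ring of functions $X\to\mathbb{Z}$ containing all constant functions. Suppose $\varphi(\bar x)$ is an $\mathcal{L}^+_R$-formula such that (1) whenever a divisibility predicate $D_\alpha$ occurs in $\varphi$, $\alpha$ is a constant function; and (2) $\varphi$ contains no term of the form $f_\alpha(s)$ where $s$ contains a variable that is within the scope of a quantifier and $\alpha$ is not a constant function. Then $\varphi(\bar x)$ is logically equivalent to a quantifier-free $\mathcal{L}^+_R$-formula which also satisfies condition (1).
   Context: Languages: $\mathcal{L}_{Pres}=\{0,1,<,-,+\}$ (constants $0,1$, order, unary negation, binary addition); $\mathcal{L}^+_{Pres}=\mathcal{L}_{Pres}\cup\{D_n : n\in\mathbb{N}\}$ with $D_n$ a unary predicate for divisibility by $n$ ($D_0$ always false); $\mathcal{L}_R=\mathcal{L}_{Pres}\cup\{f_\alpha:\alpha\in R\}$ with $f_\alpha$ unary function symbols (written $\alpha\cdot s$), and $\mathcal{L}^+_R=\mathcal{L}_R\cup\{D_\alpha:\alpha\in R\}$ with $D_\alpha$ unary predicates. Semantics depend on a parameter $t\in X$: for an $\mathcal{L}^+_R$-formula $\varphi$, $\varphi_t$ is the $\mathcal{L}^+_{Pres}$-formula obtained by replacing each term $\alpha\cdot s$ by $s+\dots+s$ ($\alpha(t)$ copies) if $\alpha(t)>0$, by $-(s+\dots+s)$ ($|\alpha(t)|$ copies) if $\alpha(t)<0$, by $0$ if $\alpha(t)=0$, and each $D_\alpha(s)$ by $D_{\alpha(t)}(s)$ (always false if $\alpha(t)=0$); $\varphi_t$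 is interpreted in $\mathbb{Z}$. Two $\mathcal{L}^+_R$-formulas $\varphi(x_1,\dots,x_d)$, $\psi(x_1,\dots,x_d)$ are logically equivalent if for every $t\in X$ and every $(k_1,\dots,k_d)\in\mathbb{Z}^d$, $\varphi_t(k_1,\dots,k_d)$ holds in $\mathbb{Z}$ iff $\psi_t(k_1,\dots,k_d)$ holds. Quantifiers range over $\mathbb{Z}$ only, never over $t$. *)

theory Defs
  imports "HOL-Library.FuncSet"
begin

section \<open>Rings of integer-valued functions\<close>

text \<open>
  Functions \<open>X \<rightarrow> \<int>\<close> are represented by extensional functions, so that two of them are equal iff
  they agree on \<open>X\<close>.
\<close>

definition const_fun :: "'x set \<Rightarrow> int \<Rightarrow> 'x \<Rightarrow> int" where
  "const_fun X c = (\<lambda>t\<in>X. c)"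

definition is_constant :: "'x set \<Rightarrow> ('x \<Rightarrow> int) \<Rightarrow> bool" where
  "is_constant X \<alpha> \<longleftrightarrow> (\<exists>c. \<forall>t\<in>X. \<alpha> t = c)"

definition function_ring :: "'x set \<Rightarrow> ('x \<Rightarrow> int) set \<Rightarrow> bool" where
  "function_ring X R \<longleftrightarrow>
     R \<subseteq> X \<rightarrow>\<^sub>E UNIV \<and>
     const_fun X 0 \<in> R \<and> const_fun X 1 \<in> R \<and>
     (\<forall>\<alpha>\<in>R. (\<lambda>t\<in>X. - \<alpha> t) \<in> R) \<and>
     (\<forall>\<alpha>\<in>R. \<forall>\<beta>\<in>R. (\<lambda>t\<in>X. \<alpha> t + \<beta> t) \<in> R \<and> (\<lambda>t\<in>X. \<alpha> t * \<beta> t) \<in> R)"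


section \<open>Syntax\<close>

datatype pterm =
    PVar nat
  | PZero
  | POne
  | PNeg pterm
  | PAdd pterm pterm

datatype (coeffs: 'f) rterm =
    RVar nat
  | RZero
  | ROne
  | RNeg "'f rterm"
  | RAdd "'f rterm" "'f rterm"
  | Scale 'f "'f rterm"

text \<open>
  First-order formulas with equality, over a type \<open>'s\<close> of terms and a type \<open>'d\<close> indexing the
  divisibility predicates.
\<close>

datatype (fm_terms: 's, fm_divs: 'd) fm =
    Eq 's 's
  | Less 's 's
  | Dvd 'd 's
  | Neg "('s, 'd) fm"
  | Conj "('s, 'd) fm" "('s, 'd) fm"
  | Disj "('s, 'd) fm" "('s, 'd) fm"
  | Imp "('s, 'd) fm" "('s, 'd) fm"
  | Iff "('s, 'd) fm" "('s, 'd) fm"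
  | Exists nat "('s, 'd) fm"
  | Forall nat "('s, 'd) fm"
  for map: map_fm

type_synonym pres_fm = "(pterm, nat) fm"

type_synonym 'x ring_fm = "(('x \<Rightarrow> int) rterm, 'x \<Rightarrow> int) fm"

definition is_LR_formula :: "('x \<Rightarrow> int) set \<Rightarrow> 'x ring_fm \<Rightarrow> bool" where
  "is_LR_formula R \<phi> \<longleftrightarrow> (\<forall>s\<in>fm_terms \<phi>. coeffs s \<subseteq> R) \<and> fm_divs \<phi> \<subseteq> R"

fun rterm_vars :: "'f rterm \<Rightarrow> nat set" where
  "rterm_vars (RVar v) = {v}"
| "rterm_vars RZero = {}"
| "rterm_vars ROne = {}"
| "rterm_vars (RNeg s) = rterm_vars s"
| "rterm_vars (RAdd s1 s2) = rterm_vars s1 \<union> rterm_vars s2"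
| "rterm_vars (Scale \<alpha> s) = rterm_vars s"

fun free_vars :: "('f rterm, 'd) fm \<Rightarrow> nat set" where
  "free_vars (Eq s1 s2) = rterm_vars s1 \<union> rterm_vars s2"
| "free_vars (Less s1 s2) = rterm_vars s1 \<union> rterm_vars s2"
| "free_vars (Dvd d s) = rterm_vars s"
| "free_vars (Neg \<phi>) = free_vars \<phi>"
| "free_vars (Conj \<phi> \<psi>) = free_vars \<phi> \<union> free_vars \<psi>"
| "free_vars (Disj \<phi> \<psi>) = free_vars \<phi> \<union> free_vars \<psi>"
| "free_vars (Imp \<phi> \<psi>) = free_vars \<phi> \<union> free_vars \<psi>"
| "free_vars (Iff \<phi> \<psi>) = free_vars \<phi> \<union> free_vars \<psi>"
| "free_vars (Exists v \<phi>) = free_vars \<phi> - {v}"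
| "free_vars (Forall v \<phi>) = free_vars \<phi> - {v}"

fun quantifier_free :: "('s, 'd) fm \<Rightarrow> bool" where
  "quantifier_free (Eq s1 s2) \<longleftrightarrow> True"
| "quantifier_free (Less s1 s2) \<longleftrightarrow> True"
| "quantifier_free (Dvd d s) \<longleftrightarrow> True"
| "quantifier_free (Neg \<phi>) \<longleftrightarrow> quantifier_free \<phi>"
| "quantifier_free (Conj \<phi> \<psi>) \<longleftrightarrow> quantifier_free \<phi> \<and> quantifier_free \<psi>"
| "quantifier_free (Disj \<phi> \<psi>) \<longleftrightarrow> quantifier_free \<phi> \<and> quantifier_free \<psi>"
| "quantifier_free (Imp \<phi> \<psi>) \<longleftrightarrow> quantifier_free \<phi> \<and> quantifier_free \<psi>"
| "quantifier_free (Iff \<phi> \<psi>) \<longleftrightarrow> quantifier_free \<phi> \<and> quantifier_free \<psi>"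
| "quantifier_free (Exists v \<phi>) \<longleftrightarrow> False"
| "quantifier_free (Forall v \<phi>) \<longleftrightarrow> False"


section \<open>Semantics\<close>

fun eval_pterm :: "(nat \<Rightarrow> int) \<Rightarrow> pterm \<Rightarrow> int" where
  "eval_pterm e (PVar v) = e v"
| "eval_pterm e PZero = 0"
| "eval_pterm e POne = 1"
| "eval_pterm e (PNeg s) = - eval_pterm e s"
| "eval_pterm e (PAdd s1 s2) = eval_pterm e s1 + eval_pterm e s2"

fun holds :: "(nat \<Rightarrow> int) \<Rightarrow> pres_fm \<Rightarrow> bool" where
  "holds e (Eq s1 s2) \<longleftrightarrow> eval_pterm e s1 = eval_pterm e s2"
| "holds e (Less s1 s2) \<longleftrightarrow> eval_pterm e s1 < eval_pterm e s2"
| "holds e (Dvd n s) \<longleftrightarrow> n \<noteq> 0 \<and> int n dvd eval_pterm e s"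
| "holds e (Neg \<phi>) \<longleftrightarrow> \<not> holds e \<phi>"
| "holds e (Conj \<phi> \<psi>) \<longleftrightarrow> holds e \<phi> \<and> holds e \<psi>"
| "holds e (Disj \<phi> \<psi>) \<longleftrightarrow> holds e \<phi> \<or> holds e \<psi>"
| "holds e (Imp \<phi> \<psi>) \<longleftrightarrow> (holds e \<phi> \<longrightarrow> holds e \<psi>)"
| "holds e (Iff \<phi> \<psi>) \<longleftrightarrow> (holds e \<phi> \<longleftrightarrow> holds e \<psi>)"
| "holds e (Exists v \<phi>) \<longleftrightarrow> (\<exists>k. holds (e(v := k)) \<phi>)"
| "holds e (Forall v \<phi>) \<longleftrightarrow> (\<forall>k. holds (e(v := k)) \<phi>)"

fun copies :: "nat \<Rightarrow> pterm \<Rightarrow> pterm" where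
  "copies 0 s = PZero"
| "copies (Suc 0) s = s"
| "copies (Suc (Suc n)) s = PAdd (copies (Suc n) s) s"

fun inst_term :: "'x \<Rightarrow> ('x \<Rightarrow> int) rterm \<Rightarrow> pterm" where
  "inst_term t (RVar v) = PVar v"
| "inst_term t RZero = PZero"
| "inst_term t ROne = POne"
| "inst_term t (RNeg s) = PNeg (inst_term t s)"
| "inst_term t (RAdd s1 s2) = PAdd (inst_term t s1) (inst_term t s2)"
| "inst_term t (Scale \<alpha> s) =
     (if \<alpha> t > 0 then copies (nat (\<alpha> t)) (inst_term t s)
      else if \<alpha> t < 0 then PNeg (copies (nat \<bar>\<alpha> t\<bar>) (inst_term t s))
      else PZero)"

text \<open>
  The formula \<open>\<phi>\<^sub>t\<close>. The predicates \<open>D\<^sub>n\<close> are indexed by natural numbers; for \<open>\<alpha> t < 0\<close>,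
  divisibility by \<open>\<alpha> t\<close> is divisibility by \<open>\<bar>\<alpha> t\<bar>\<close>.
\<close>

definition inst_fm :: "'x \<Rightarrow> 'x ring_fm \<Rightarrow> pres_fm" where
  "inst_fm t = map_fm (inst_term t) (\<lambda>\<alpha>. nat \<bar>\<alpha> t\<bar>)"

text \<open>
  A tuple of integers assigned to \<open>x\<^sub>1, \<dots>, x\<^sub>d\<close> is given by a valuation \<open>e\<close> of all variables; only
  the values at the free variables matter.
\<close>

definition logically_equivalent :: "'x set \<Rightarrow> 'x ring_fm \<Rightarrow> 'x ring_fm \<Rightarrow> bool" where
  "logically_equivalent X \<phi> \<psi> \<longleftrightarrow>
     (\<forall>t\<in>X. \<forall>e. holds e (inst_fm t \<phi>) \<longleftrightarrow> holds e (inst_fm t \<psi>))"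


section \<open>The two syntactic conditions\<close>

definition constant_divisors :: "'x set \<Rightarrow> 'x ring_fm \<Rightarrow> bool" where
  "constant_divisors X \<phi> \<longleftrightarrow> (\<forall>\<alpha>\<in>fm_divs \<phi>. is_constant X \<alpha>)"

text \<open>
  The argument \<open>B\<close> is the set of variables bound by the quantifiers in whose scope the given term or
  subformula lies.
\<close>

fun term_coeffs_ok :: "'x set \<Rightarrow> nat set \<Rightarrow> ('x \<Rightarrow> int) rterm \<Rightarrow> bool" where
  "term_coeffs_ok X B (RVar v) \<longleftrightarrow> True"
| "term_coeffs_ok X B RZero \<longleftrightarrow> True"
| "term_coeffs_ok X B ROne \<longleftrightarrow> True"
| "term_coeffs_ok X B (RNeg s) \<longleftrightarrow> term_coeffs_ok X B s"
| "term_coeffs_ok X B (RAdd s1 s2) \<longleftrightarrow> term_coeffs_ok X B s1 \<and> term_coeffs_ok X B s2"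
| "term_coeffs_ok X B (Scale \<alpha> s) \<longleftrightarrow>
     \<not> (rterm_vars s \<inter> B \<noteq> {} \<and> \<not> is_constant X \<alpha>) \<and> term_coeffs_ok X B s"

fun fm_coeffs_ok :: "'x set \<Rightarrow> nat set \<Rightarrow> 'x ring_fm \<Rightarrow> bool" where
  "fm_coeffs_ok X B (Eq s1 s2) \<longleftrightarrow> term_coeffs_ok X B s1 \<and> term_coeffs_ok X B s2"
| "fm_coeffs_ok X B (Less s1 s2) \<longleftrightarrow> term_coeffs_ok X B s1 \<and> term_coeffs_ok X B s2"
| "fm_coeffs_ok X B (Dvd \<alpha> s) \<longleftrightarrow> term_coeffs_ok X B s"
| "fm_coeffs_ok X B (Neg \<phi>) \<longleftrightarrow> fm_coeffs_ok X B \<phi>"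
| "fm_coeffs_ok X B (Conj \<phi> \<psi>) \<longleftrightarrow> fm_coeffs_ok X B \<phi> \<and> fm_coeffs_ok X B \<psi>"
| "fm_coeffs_ok X B (Disj \<phi> \<psi>) \<longleftrightarrow> fm_coeffs_ok X B \<phi> \<and> fm_coeffs_ok X B \<psi>"
| "fm_coeffs_ok X B (Imp \<phi> \<psi>) \<longleftrightarrow> fm_coeffs_ok X B \<phi> \<and> fm_coeffs_ok X B \<psi>"
| "fm_coeffs_ok X B (Iff \<phi> \<psi>) \<longleftrightarrow> fm_coeffs_ok X B \<phi> \<and> fm_coeffs_ok X B \<psi>"
| "fm_coeffs_ok X B (Exists v \<phi>) \<longleftrightarrow> fm_coeffs_ok X (insert v B) \<phi>"
| "fm_coeffs_ok X B (Forall v \<phi>) \<longleftrightarrow> fm_coeffs_ok X (insert v B) \<phi>"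

definition bound_coeffs_constant :: "'x set \<Rightarrow> 'x ring_fm \<Rightarrow> bool" where
  "bound_coeffs_constant X \<phi> \<longleftrightarrow> fm_coeffs_ok X {} \<phi>"

end

theory Submission
  imports Defs
begin

text \<open>
  Cooper's quantifier elimination, uniformly in the parameter \<open>t\<close>. The coefficients of a bound
  variable \<open>v\<close> and all moduli are integers independent of \<open>t\<close>, so a quantifier-free predicate \<open>P\<close> of
  \<open>v\<close> has a period \<open>D\<close> and finitely many affine expressions \<open>s / n\<close> in the other variables, all
  chosen independently of \<open>t\<close>, such that \<open>P\<close> can differ at \<open>k - D\<close> and \<open>k\<close> only if \<open>k\<close> lies in some
  interval \<open>[s / n, s / n + D]\<close>. Descending from a witness in steps of \<open>D\<close> therefore ends either at
  one of finitely many candidates \<open>(s + j) / n\<close> or in the region near \<open>-\<infinity>\<close>, where \<open>P\<close> is periodic.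
  Multiplying the atoms by \<open>n\<close> makes substitution of \<open>(s + j) / n\<close> expressible.
\<close>

section \<open>Evaluation of instantiated terms\<close>

lemma eval_copies: "eval_pterm e (copies n s) = int n * eval_pterm e s"
  by (induction n s rule: copies.induct) (auto simp: algebra_simps)

lemma eval_inst_scale:
  "eval_pterm e (inst_term t (Scale \<alpha> s)) = \<alpha> t * eval_pterm e (inst_term t s)"
  by (auto simp: eval_copies)

locale integer_function_ring =
  fixes X :: "'x set" and R :: "('x \<Rightarrow> int) set"
  assumes ring: "function_ring X R"
    and const_in_ring: "\<And>c. const_fun X c \<in> R"
begin

section \<open>Affine functions and quantifier-free predicates\<close>

text \<open>Members of \<open>R\<close> are extensional. Restricting to \<open>X\<close> before
  testing membership lets coefficients be plain lambda abstractions.\<close>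

definition coeff :: "('x \<Rightarrow> int) \<Rightarrow> bool" where
  "coeff \<alpha> \<longleftrightarrow> restrict \<alpha> X \<in> R"

lemma coeff_const: "coeff (\<lambda>t. c)"
  using const_in_ring[of c] by (simp add: coeff_def const_fun_def)

lemma coeff_ring_member:
  assumes "\<alpha> \<in> R"
  shows "coeff \<alpha>"
proof -
  have "\<alpha> \<in> X \<rightarrow>\<^sub>E UNIV" using assms ring by (auto simp: function_ring_def)
  then have "restrict \<alpha> X = \<alpha>" by (rule PiE_restrict)
  with assms show ?thesis by (simp add: coeff_def)
qed

lemma coeff_mult:
  assumes "coeff \<alpha>" "coeff \<beta>"
  shows "coeff (\<lambda>t. \<alpha> t * \<beta> t)"
proof -
  have "(\<lambda>t\<in>X. restrict \<alpha> X t * restrict \<beta> X t) \<in> R"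
    using assms ring unfolding function_ring_def coeff_def by blast
  moreover have "(\<lambda>t\<in>X. restrict \<alpha> X t * restrict \<beta> X t) = (\<lambda>t\<in>X. \<alpha> t * \<beta> t)"
    by (rule restrict_ext) simp
  ultimately show ?thesis by (simp add: coeff_def)
qed

lemma is_constant_const: "is_constant X (\<lambda>t. c)"
  by (auto simp: is_constant_def)

lemma is_constant_mult:
  assumes "is_constant X \<alpha>" "is_constant X \<beta>"
  shows "is_constant X (\<lambda>t. \<alpha> t * \<beta> t)"
proof -
  obtain c d where "\<forall>t\<in>X. \<alpha> t = c" "\<forall>t\<in>X. \<beta> t = d"
    using assms by (auto simp: is_constant_def)
  then have "\<forall>t\<in>X. \<alpha> t * \<beta> t = c * d" by simp
  then show ?thesis unfolding is_constant_def by blast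
qed

text \<open>Term functions, taken semantically so that no syntactic normal form is needed.
  \<open>V\<close> holds the variables that may occur and \<open>B\<close> the bound ones; the side
  condition on monomials is hypothesis (2).\<close>

inductive affine :: "nat set \<Rightarrow> nat set \<Rightarrow> ('x \<Rightarrow> (nat \<Rightarrow> int) \<Rightarrow> int) \<Rightarrow> bool"
  for B V where
  affine_coeff: "coeff \<alpha> \<Longrightarrow> affine B V (\<lambda>t e. \<alpha> t)"
| affine_monomial: "\<lbrakk>coeff \<alpha>; v \<in> V; v \<in> B \<Longrightarrow> is_constant X \<alpha>\<rbrakk> \<Longrightarrow> affine B V (\<lambda>t e. \<alpha> t * e v)"
| affine_add: "\<lbrakk>affine B V g; affine B V h\<rbrakk> \<Longrightarrow> affine B V (\<lambda>t e. g t e + h t e)"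

text \<open>Hypothesis (1) is built in: a modulus \<open>m\<close> is an integer and cannot vary
  with \<open>t\<close>. The rule \<open>qf_cong\<close> makes only the values at
  \<open>t \<in> X\<close> count.\<close>

inductive qf_pred :: "nat set \<Rightarrow> nat set \<Rightarrow> ('x \<Rightarrow> (nat \<Rightarrow> int) \<Rightarrow> bool) \<Rightarrow> bool"
  for B V where
  qf_pos: "affine B V g \<Longrightarrow> qf_pred B V (\<lambda>t e. 0 < g t e)"
| qf_dvd: "\<lbrakk>affine B V g; m > 0\<rbrakk> \<Longrightarrow> qf_pred B V (\<lambda>t e. m dvd g t e)"
| qf_not: "qf_pred B V P \<Longrightarrow> qf_pred B V (\<lambda>t e. \<not> P t e)"
| qf_conj: "\<lbrakk>qf_pred B V P; qf_pred B V Q\<rbrakk> \<Longrightarrow> qf_pred B V (\<lambda>t e. P t e \<and> Q t e)"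
| qf_cong: "\<lbrakk>qf_pred B V P; \<And>t e. t \<in> X \<Longrightarrow> P t e \<longleftrightarrow> Q t e\<rbrakk> \<Longrightarrow> qf_pred B V Q"

section \<open>Closure properties of affine functions\<close>

lemma affine_mono:
  assumes "affine B V g" "B' \<subseteq> B" "V \<subseteq> V'"
  shows "affine B' V' g"
  using assms by (induction rule: affine.induct) (auto intro: affine.intros)

lemma affine_const: "affine B V (\<lambda>t e. c)"
  by (rule affine_coeff[OF coeff_const])

text \<open>The last premise is what hypothesis (2) grants for a term
  \<open>Scale \<alpha> s\<close>: a non-constant factor only ever meets monomials whose variable is
  outside \<open>B\<close>.\<close>

lemma affine_scale:
  assumes "affine B V g" "coeff \<alpha>" "is_constant X \<alpha> \<or> V \<inter> B = {}"
  shows "affine B V (\<lambda>t e. \<alpha> t * g t e)"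
  using assms(1)
proof (induction rule: affine.induct)
  case (affine_coeff \<beta>)
  show ?case by (rule affine.affine_coeff[OF coeff_mult[OF assms(2) affine_coeff]])
next
  case (affine_monomial \<beta> v)
  have "affine B V (\<lambda>t e. (\<alpha> t * \<beta> t) * e v)"
    using affine_monomial assms(2,3)
    by (intro affine.affine_monomial coeff_mult is_constant_mult) auto
  then show ?case by (simp add: mult.assoc)
next
  case (affine_add g h)
  show ?case using affine.affine_add[OF affine_add.IH] by (simp add: distrib_left)
qed

lemma affine_const_mult:
  assumes "affine B V g"
  shows "affine B V (\<lambda>t e. c * g t e)"
  using affine_scale[OF assms coeff_const[of c]] is_constant_const by simp

lemma affine_minus:
  assumes "affine B V g"
  shows "affine B V (\<lambda>t e. - g t e)"
  using affine_const_mult[OF assms, of "-1"] by simp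

lemma affine_diff:
  assumes "affine B V g" "affine B V h"
  shows "affine B V (\<lambda>t e. g t e - h t e)"
  using affine_add[OF assms(1) affine_minus[OF assms(2)]] by simp

lemma affine_fun_upd:
  assumes "affine B (V - {v}) g"
  shows "g t (e(v := k)) = g t e"
  using assms by (induction rule: affine.induct) auto

text \<open>As \<open>v \<in> B\<close>, every coefficient of \<open>v\<close> is constant on
  \<open>X\<close>, so these coefficients add up to one integer \<open>c\<close> independent of
  \<open>t\<close>. All uniformity in \<open>t\<close> of the elimination rests on this.\<close>

lemma affine_split:
  assumes "affine B V g" "v \<in> B"
  obtains c h where "affine B (V - {v}) h" "\<And>t e. t \<in> X \<Longrightarrow> g t e = c * e v + h t e"
proof -
  have "\<exists>c h. affine B (V - {v}) h \<and> (\<forall>t\<in>X. \<forall>e. g t e = c * e v + h t e)"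
    using assms(1)
  proof (induction rule: affine.induct)
    case (affine_coeff \<alpha>)
    show ?case
      by (intro exI[of _ 0] exI[of _ "\<lambda>t e. \<alpha> t"]) (simp add: affine.affine_coeff affine_coeff)
  next
    case (affine_monomial \<alpha> w)
    show ?case
    proof (cases "w = v")
      case True
      then obtain c where "\<forall>t\<in>X. \<alpha> t = c"
        using affine_monomial assms(2) by (auto simp: is_constant_def)
      then show ?thesis
        using True by (intro exI[of _ c] exI[of _ "\<lambda>t e. 0"]) (simp add: affine_const)
    next
      case False
      then show ?thesis
        using affine_monomial
        by (intro exI[of _ 0] exI[of _ "\<lambda>t e. \<alpha> t * e w"]) (simp add: affine.affine_monomial)
    qed
  next
    case (affine_add g1 g2)
    then obtain c1 h1 c2 h2 where
      "affine B (V - {v}) h1" "\<forall>t\<in>X. \<forall>e. g1 t e = c1 * e v + h1 t e"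
      "affine B (V - {v}) h2" "\<forall>t\<in>X. \<forall>e. g2 t e = c2 * e v + h2 t e"
      by blast
    then show ?case
      by (intro exI[of _ "c1 + c2"] exI[of _ "\<lambda>t e. h1 t e + h2 t e"])
        (simp add: affine.affine_add algebra_simps)
  qed
  with that show thesis by blast
qed

section \<open>Closure properties of quantifier-free predicates\<close>

lemma qf_mono:
  assumes "qf_pred B V P" "B' \<subseteq> B" "V \<subseteq> V'"
  shows "qf_pred B' V' P"
  using assms by (induction rule: qf_pred.induct) (auto intro: qf_pred.intros affine_mono)

lemma qf_const: "qf_pred B V (\<lambda>t e. b)"
  using qf_pos[OF affine_const[of B V "if b then 1 else 0"]] by (cases b) auto

lemma qf_disj:
  assumes "qf_pred B V P" "qf_pred B V Q"
  shows "qf_pred B V (\<lambda>t e. P t e \<or> Q t e)"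
  using qf_not[OF qf_conj[OF qf_not[OF assms(1)] qf_not[OF assms(2)]]] by simp

lemma qf_imp:
  assumes "qf_pred B V P" "qf_pred B V Q"
  shows "qf_pred B V (\<lambda>t e. P t e \<longrightarrow> Q t e)"
  using qf_disj[OF qf_not[OF assms(1)] assms(2)] by (simp only: imp_conv_disj)

lemma qf_bex:
  assumes "finite A" "\<And>a. a \<in> A \<Longrightarrow> qf_pred B V (P a)"
  shows "qf_pred B V (\<lambda>t e. \<exists>a\<in>A. P a t e)"
  using assms by (induction A rule: finite_induct) (simp_all add: qf_const qf_disj)

section \<open>Elimination of one quantifier\<close>

text \<open>Write an atom's function as \<open>c * v + h\<close>. If \<open>n * k = s\<close>, then
  \<open>n\<close> times its value at \<open>k\<close> is \<open>c * s + n * h\<close>, which is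
  free of \<open>v\<close>. Since \<open>n > 0\<close>, this scaling keeps the sign, and it keeps
  divisibility once the modulus becomes \<open>n * m\<close>.\<close>

lemma qf_subst_quotient:
  assumes "qf_pred B V P" "v \<in> B" "affine B (V - {v}) s" "n > 0"
  obtains Q where "qf_pred B (V - {v}) Q"
    "\<And>t e k. \<lbrakk>t \<in> X; n * k = s t e\<rbrakk> \<Longrightarrow> Q t e \<longleftrightarrow> P t (e(v := k))"
proof -
  have "\<exists>Q. qf_pred B (V - {v}) Q \<and>
      (\<forall>t\<in>X. \<forall>e k. n * k = s t e \<longrightarrow> (Q t e \<longleftrightarrow> P t (e(v := k))))"
    using assms(1)
  proof (induction rule: qf_pred.induct)
    case (qf_pos g)
    obtain c h where h: "affine B (V - {v}) h" "\<And>t e. t \<in> X \<Longrightarrow> g t e = c * e v + h t e"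
      using affine_split[OF qf_pos assms(2)] by metis
    have eq: "c * s t e + n * h t e = n * g t (e(v := k))" if "t \<in> X" "n * k = s t e" for t e k
      using that h by (simp add: affine_fun_upd[OF h(1)] algebra_simps flip: that(2))
    have "qf_pred B (V - {v}) (\<lambda>t e. 0 < c * s t e + n * h t e)"
      by (intro qf_pred.qf_pos affine_add affine_const_mult assms h)
    moreover have "\<forall>t\<in>X. \<forall>e k. n * k = s t e \<longrightarrow>
        (0 < c * s t e + n * h t e \<longleftrightarrow> 0 < g t (e(v := k)))"
      using eq assms(4) by (simp add: zero_less_mult_iff)
    ultimately show ?case by blast
  next
    case (qf_dvd g m)
    obtain c h where h: "affine B (V - {v}) h" "\<And>t e. t \<in> X \<Longrightarrow> g t e = c * e v + h t e"
      using affine_split[OF qf_dvd(1) assms(2)] by metis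
    have eq: "c * s t e + n * h t e = n * g t (e(v := k))" if "t \<in> X" "n * k = s t e" for t e k
      using that h by (simp add: affine_fun_upd[OF h(1)] algebra_simps flip: that(2))
    have "qf_pred B (V - {v}) (\<lambda>t e. n * m dvd c * s t e + n * h t e)"
      using assms(4) qf_dvd(2)
      by (intro qf_pred.qf_dvd affine_add affine_const_mult assms h) simp
    moreover have "\<forall>t\<in>X. \<forall>e k. n * k = s t e \<longrightarrow>
        (n * m dvd c * s t e + n * h t e \<longleftrightarrow> m dvd g t (e(v := k)))"
      using eq assms(4) by simp
    ultimately show ?case by blast
  next
    case (qf_not P)
    then obtain Q where "qf_pred B (V - {v}) Q"
      "\<forall>t\<in>X. \<forall>e k. n * k = s t e \<longrightarrow> (Q t e \<longleftrightarrow> P t (e(v := k)))"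
      by blast
    then show ?case by (intro exI[of _ "\<lambda>t e. \<not> Q t e"]) (simp add: qf_pred.qf_not del: fun_upd_apply)
  next
    case (qf_conj P1 P2)
    then obtain Q1 Q2 where
      "qf_pred B (V - {v}) Q1" "\<forall>t\<in>X. \<forall>e k. n * k = s t e \<longrightarrow> (Q1 t e \<longleftrightarrow> P1 t (e(v := k)))"
      "qf_pred B (V - {v}) Q2" "\<forall>t\<in>X. \<forall>e k. n * k = s t e \<longrightarrow> (Q2 t e \<longleftrightarrow> P2 t (e(v := k)))"
      by blast
    then show ?case
      by (intro exI[of _ "\<lambda>t e. Q1 t e \<and> Q2 t e"]) (simp add: qf_pred.qf_conj del: fun_upd_apply)
  next
    case (qf_cong P Q)
    then show ?case by metis
  qed
  with that show thesis by blast
qed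

text \<open>Far to the left, a positivity atom is decided by the sign of the coefficient of
  \<open>v\<close>, while a divisibility atom depends on \<open>k\<close> only modulo
  \<open>m\<close>. The bound \<open>z\<close> may vary with \<open>t\<close> and \<open>e\<close>;
  the period \<open>D\<close> may not.\<close>

lemma qf_near_minus_infinity:
  assumes "qf_pred B V P" "v \<in> B"
  obtains Pinf D where "D > 0" "\<And>k. qf_pred B (V - {v}) (Pinf k)"
    "\<And>k i t e. t \<in> X \<Longrightarrow> Pinf (k + i * D) t e \<longleftrightarrow> Pinf k t e"
    "\<And>t e. t \<in> X \<Longrightarrow> \<exists>z. \<forall>k\<le>z. P t (e(v := k)) \<longleftrightarrow> Pinf k t e"
proof -
  have "\<exists>Pinf D. D > 0 \<and> (\<forall>k. qf_pred B (V - {v}) (Pinf k)) \<and>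
      (\<forall>t\<in>X. \<forall>k i e. Pinf (k + i * D) t e \<longleftrightarrow> Pinf k t e) \<and>
      (\<forall>t\<in>X. \<forall>e. \<exists>z. \<forall>k\<le>z. P t (e(v := k)) \<longleftrightarrow> Pinf k t e)"
    using assms(1)
  proof (induction rule: qf_pred.induct)
    case (qf_pos g)
    obtain c h where h: "affine B (V - {v}) h" "\<And>t e. t \<in> X \<Longrightarrow> g t e = c * e v + h t e"
      using affine_split[OF qf_pos assms(2)] by metis
    have g: "g t (e(v := k)) = c * k + h t e" if "t \<in> X" for t e k
      using that h by (simp add: affine_fun_upd[OF h(1)])
    define Q where "Q = (\<lambda>(k::int) t e. c < 0 \<or> c = 0 \<and> 0 < h t e)"
    have "\<exists>z. \<forall>k\<le>z. 0 < g t (e(v := k)) \<longleftrightarrow> Q k t e" if t: "t \<in> X" for t e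
    \<comment> \<open>For \<open>k\<close> up to this bound and an integer
      \<open>c \<noteq> 0\<close>, the absolute value of \<open>c * k\<close> is at least
      \<open>- k\<close>, hence exceeds that of \<open>h t e\<close>, so \<open>c * k\<close>
      determines the sign.\<close>
    proof (intro exI[of _ "- \<bar>h t e\<bar> - 1"] allI impI)
      fix k
      assume k: "k \<le> - \<bar>h t e\<bar> - 1"
      consider "c < 0" | "c = 0" | "c > 0" by linarith
      then show "0 < g t (e(v := k)) \<longleftrightarrow> Q k t e"
      proof cases
        case 1
        then have "(- c) * (- k) \<ge> 1 * (- k)" using k by (intro mult_right_mono) auto
        then show ?thesis using 1 k by (simp add: g[OF t] Q_def)
      next
        case 2
        then show ?thesis by (simp add: g[OF t] Q_def)
      next
        case 3
        then have "c * (- k) \<ge> 1 * (- k)" using k by (intro mult_right_mono) auto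
        then show ?thesis using 3 k by (simp add: g[OF t] Q_def)
      qed
    qed
    moreover have "qf_pred B (V - {v}) (Q k)" for k
      unfolding Q_def by (intro qf_disj qf_conj qf_const qf_pred.qf_pos h)
    ultimately show ?case
      by (intro exI[of _ Q] exI[of _ 1]) (simp add: Q_def del: fun_upd_apply)
  next
    case (qf_dvd g m)
    obtain c h where h: "affine B (V - {v}) h" "\<And>t e. t \<in> X \<Longrightarrow> g t e = c * e v + h t e"
      using affine_split[OF qf_dvd(1) assms(2)] by metis
    define Q where "Q = (\<lambda>k t e. m dvd c * k + h t e)"
    have "Q (k + i * m) t e \<longleftrightarrow> Q k t e" for k i t e
    proof -
      have "c * (k + i * m) + h t e = (c * k + h t e) + m * (c * i)" by (simp add: algebra_simps)
      then show ?thesis by (simp only: Q_def dvd_add_times_triv_right_iff mult.commute[of m])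
    qed
    moreover have "qf_pred B (V - {v}) (Q k)" for k
      unfolding Q_def by (intro qf_pred.qf_dvd affine_add affine_const h qf_dvd)
    moreover have "m dvd g t (e(v := k)) \<longleftrightarrow> Q k t e" if "t \<in> X" for t e k
      using that h by (simp add: affine_fun_upd[OF h(1)] Q_def)
    ultimately show ?case
      using qf_dvd(2) by (intro exI[of _ Q] exI[of _ m]) (simp del: fun_upd_apply)
  next
    case (qf_not P)
    then obtain Q D where "D > 0" "\<forall>k. qf_pred B (V - {v}) (Q k)"
      "\<forall>t\<in>X. \<forall>k i e. Q (k + i * D) t e \<longleftrightarrow> Q k t e"
      "\<forall>t\<in>X. \<forall>e. \<exists>z. \<forall>k\<le>z. P t (e(v := k)) \<longleftrightarrow> Q k t e"
      by blast
    then show ?case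
      by (intro exI[of _ "\<lambda>k t e. \<not> Q k t e"] exI[of _ D]) (simp add: qf_pred.qf_not del: fun_upd_apply)
  next
    case (qf_conj P1 P2)
    then obtain Q1 D1 Q2 D2 where
      1: "D1 > 0" "\<forall>k. qf_pred B (V - {v}) (Q1 k)"
      "\<forall>t\<in>X. \<forall>k i e. Q1 (k + i * D1) t e \<longleftrightarrow> Q1 k t e"
      "\<forall>t\<in>X. \<forall>e. \<exists>z. \<forall>k\<le>z. P1 t (e(v := k)) \<longleftrightarrow> Q1 k t e" and
      2: "D2 > 0" "\<forall>k. qf_pred B (V - {v}) (Q2 k)"
      "\<forall>t\<in>X. \<forall>k i e. Q2 (k + i * D2) t e \<longleftrightarrow> Q2 k t e"
      "\<forall>t\<in>X. \<forall>e. \<exists>z. \<forall>k\<le>z. P2 t (e(v := k)) \<longleftrightarrow> Q2 k t e"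
      by blast
    \<comment> \<open>The product \<open>D1 * D2\<close> is a common period: \<open>i\<close> steps
      of it are \<open>i * D2\<close> steps of \<open>D1\<close> and \<open>i * D1\<close> steps of
      \<open>D2\<close>.\<close>
    have "Q1 (k + i * (D1 * D2)) t e \<longleftrightarrow> Q1 k t e" if "t \<in> X" for k i t e
      using 1(3)[rule_format, OF that, of k "i * D2" e] by (simp add: mult_ac)
    moreover have "Q2 (k + i * (D1 * D2)) t e \<longleftrightarrow> Q2 k t e" if "t \<in> X" for k i t e
      using 2(3)[rule_format, OF that, of k "i * D1" e] by (simp add: mult_ac)
    moreover have "\<exists>z. \<forall>k\<le>z. (P1 t (e(v := k)) \<and> P2 t (e(v := k))) \<longleftrightarrow> (Q1 k t e \<and> Q2 k t e)"
      if t: "t \<in> X" for t e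
    proof -
      obtain z1 z2 where "\<forall>k\<le>z1. P1 t (e(v := k)) \<longleftrightarrow> Q1 k t e"
        "\<forall>k\<le>z2. P2 t (e(v := k)) \<longleftrightarrow> Q2 k t e"
        using 1(4) 2(4) t by meson
      then show ?thesis by (intro exI[of _ "min z1 z2"]) simp
    qed
    ultimately show ?case
      using 1(1,2) 2(1,2)
      by (intro exI[of _ "\<lambda>k t e. Q1 k t e \<and> Q2 k t e"] exI[of _ "D1 * D2"])
        (simp add: qf_pred.qf_conj del: fun_upd_apply)
  next
    case (qf_cong P Q)
    then show ?case by simp
  qed
  with that show thesis by blast
qed

text \<open>
  A pair \<open>(n, s)\<close> in \<open>S\<close> stands for the possibly non-integral breakpoint \<open>s / n\<close>.
\<close>

definition breakpoints ::
  "nat \<Rightarrow> int \<Rightarrow> (int \<times> ('x \<Rightarrow> (nat \<Rightarrow> int) \<Rightarrow> int)) set \<Rightarrow> ('x \<Rightarrow> (nat \<Rightarrow> int) \<Rightarrow> bool) \<Rightarrow> bool"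
  where
  "breakpoints v D S P \<longleftrightarrow>
     (\<forall>t\<in>X. \<forall>e k. P t (e(v := k)) \<noteq> P t (e(v := k - D)) \<longrightarrow>
        (\<exists>(n, s)\<in>S. \<exists>j\<in>{0..n * D}. n * k = s t e + j))"

text \<open>A change across a step of length \<open>D * m\<close> happens across one of the
  \<open>m\<close> substeps of length \<open>D\<close>. The breakpoint found at
  \<open>k - D * i\<close> serves \<open>k\<close> as well, with \<open>j\<close> enlarged by
  \<open>n * D * i\<close>.\<close>

lemma breakpoints_multiple:
  assumes "breakpoints v D S P" "D > 0" "m > 0" "\<forall>(n, s)\<in>S. n > 0"
  shows "breakpoints v (D * m) S P"
  unfolding breakpoints_def
proof (intro ballI allI impI)
  fix t e k
  assume t: "t \<in> X" and ne: "P t (e(v := k)) \<noteq> P t (e(v := k - D * m))"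
  have "\<exists>i::nat. int i < m \<and>
      P t (e(v := k - D * int i)) \<noteq> P t (e(v := k - D * int i - D))"
  proof (rule ccontr)
    assume *: "\<not> ?thesis"
    have "int i \<le> m \<longrightarrow> P t (e(v := k - D * int i)) = P t (e(v := k))" for i :: nat
      using * by (induction i) (auto simp: algebra_simps)
    from this[of "nat m"] show False using ne \<open>m > 0\<close> by simp
  qed
  then obtain i :: nat where i: "int i < m"
    "P t (e(v := k - D * int i)) \<noteq> P t (e(v := k - D * int i - D))" by blast
  then obtain n s j where S: "(n, s) \<in> S" and j: "j \<in> {0..n * D}"
    and eq: "n * (k - D * int i) = s t e + j"
    using assms(1) t unfolding breakpoints_def by fast
  have "n > 0" using S assms(4) by blast
  \<comment> \<open>From \<open>i < m\<close> and \<open>j \<le> n * D\<close>, the enlarged offset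
    is at most \<open>n * D * (i + 1)\<close>, so it stays in the longer range.\<close>
  have "n * D * (int i + 1) \<le> n * D * m"
    using i \<open>n > 0\<close> \<open>D > 0\<close> by (intro mult_left_mono) auto
  then have "j + n * D * int i \<in> {0..n * (D * m)}"
    using j \<open>n > 0\<close> \<open>D > 0\<close> by (auto simp: algebra_simps)
  moreover have "n * k = s t e + (j + n * D * int i)"
    using eq by (simp add: algebra_simps)
  ultimately show "\<exists>(n, s)\<in>S. \<exists>j\<in>{0..n * (D * m)}. n * k = s t e + j"
    using S by blast
qed

lemma breakpoints_conj:
  assumes "breakpoints v D S P" "breakpoints v D S' Q"
  shows "breakpoints v D (S \<union> S') (\<lambda>t e. P t e \<and> Q t e)"
  unfolding breakpoints_def
proof (intro ballI allI impI)
  fix t e k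
  assume t: "t \<in> X" and "(P t (e(v := k)) \<and> Q t (e(v := k))) \<noteq>
    (P t (e(v := k - D)) \<and> Q t (e(v := k - D)))"
  then consider "P t (e(v := k)) \<noteq> P t (e(v := k - D))" | "Q t (e(v := k)) \<noteq> Q t (e(v := k - D))"
    by blast
  then show "\<exists>(n, s)\<in>S \<union> S'. \<exists>j\<in>{0..n * D}. n * k = s t e + j"
    using assms t unfolding breakpoints_def by cases fast+
qed

text \<open>Positivity of \<open>c * v + h\<close> changes only where the expression crosses zero,
  near \<open>- h / c\<close>. A divisibility atom never changes across a step of length
  \<open>m\<close>. Negation keeps breakpoints; a conjunction merges them after passing to the
  common step \<open>D1 * D2\<close>.\<close>

lemma qf_breakpoints:
  assumes "qf_pred B V P" "v \<in> B"
  obtains D S where "D > 0" "finite S" "\<forall>(n, s)\<in>S. n > 0 \<and> affine B (V - {v}) s"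
    "breakpoints v D S P"
proof -
  have "\<exists>D S. D > 0 \<and> finite S \<and> (\<forall>(n, s)\<in>S. n > 0 \<and> affine B (V - {v}) s) \<and>
      breakpoints v D S P"
    using assms(1)
  proof (induction rule: qf_pred.induct)
    case (qf_pos g)
    obtain c h where h: "affine B (V - {v}) h" "\<And>t e. t \<in> X \<Longrightarrow> g t e = c * e v + h t e"
      using affine_split[OF qf_pos assms(2)] by metis
    have g: "g t (e(v := k)) = c * k + h t e" if "t \<in> X" for t e k
      using that h by (simp add: affine_fun_upd[OF h(1)])
    consider "c > 0" | "c = 0" | "c < 0" by linarith
    then show ?case
    proof cases
      case 1
      \<comment> \<open>A change from \<open>k - 1\<close> to \<open>k\<close> means
        \<open>0 < c * k + h \<le> c\<close>, so the offset \<open>j = c * k + h\<close> lies in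
        \<open>{1..c}\<close>.\<close>
      have "breakpoints v 1 {(c, \<lambda>t e. - h t e)} (\<lambda>t e. 0 < g t e)"
        using 1 by (auto simp: breakpoints_def g algebra_simps)
      then show ?thesis
        using 1 affine_minus[OF h(1)]
        by (intro exI[of _ 1] exI[of _ "{(c, \<lambda>t e. - h t e)}"]) simp
    next
      case 2
      then have "breakpoints v 1 {} (\<lambda>t e. 0 < g t e)"
        by (simp add: breakpoints_def g)
      then show ?thesis by (intro exI[of _ 1] exI[of _ "{}"]) simp
    next
      case 3
      have "breakpoints v 1 {(- c, h)} (\<lambda>t e. 0 < g t e)"
        unfolding breakpoints_def
      proof (intro ballI allI impI)
        fix t e k
        assume t: "t \<in> X" and "(0 < g t (e(v := k))) \<noteq> (0 < g t (e(v := k - 1)))"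
        \<comment> \<open>Here the change gives \<open>c < c * k + h \<le> 0\<close>, so the offset
          can be 0 but not \<open>- c\<close>. The closed range in \<open>breakpoints\<close> covers
          both signs of \<open>c\<close>.\<close>
        then have "- (c * k) - h t e \<in> {0..- c}"
          using 3 by (auto simp: g algebra_simps)
        then show "\<exists>(n, s)\<in>{(- c, h)}. \<exists>j\<in>{0..n * 1}. n * k = s t e + j"
          by (auto intro!: bexI[of _ "- (c * k) - h t e"])
      qed
      then show ?thesis
        using 3 h(1) by (intro exI[of _ 1] exI[of _ "{(- c, h)}"]) simp
    qed
  next
    case (qf_dvd g m)
    obtain c h where h: "affine B (V - {v}) h" "\<And>t e. t \<in> X \<Longrightarrow> g t e = c * e v + h t e"
      using affine_split[OF qf_dvd(1) assms(2)] by metis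
    have "m dvd g t (e(v := k)) \<longleftrightarrow> m dvd g t (e(v := k - m))" if "t \<in> X" for t e k
    proof -
      have "g t (e(v := k)) = g t (e(v := k - m)) + c * m"
        using that h by (simp add: affine_fun_upd[OF h(1)] algebra_simps)
      then show ?thesis by (simp only: dvd_add_times_triv_right_iff)
    qed
    then have "breakpoints v m {} (\<lambda>t e. m dvd g t e)"
      unfolding breakpoints_def by blast
    then show ?case
      using qf_dvd(2) by (intro exI[of _ m] exI[of _ "{}"]) simp
  next
    case (qf_not P)
    then show ?case by (simp add: breakpoints_def)
  next
    case (qf_conj P1 P2)
    then obtain D1 S1 D2 S2 where
      1: "D1 > 0" "finite S1" "\<forall>(n, s)\<in>S1. n > 0 \<and> affine B (V - {v}) s" "breakpoints v D1 S1 P1" and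
      2: "D2 > 0" "finite S2" "\<forall>(n, s)\<in>S2. n > 0 \<and> affine B (V - {v}) s" "breakpoints v D2 S2 P2"
      by blast
    have "breakpoints v (D1 * D2) S1 P1"
      using 1 2 by (intro breakpoints_multiple) auto
    moreover have "breakpoints v (D1 * D2) S2 P2"
      using breakpoints_multiple[of v D2 S2 P2 D1] 1 2 by (auto simp: mult.commute)
    ultimately have "breakpoints v (D1 * D2) (S1 \<union> S2) (\<lambda>t e. P1 t e \<and> P2 t e)"
      by (rule breakpoints_conj)
    then show ?case
      using 1 2 by (intro exI[of _ "D1 * D2"] exI[of _ "S1 \<union> S2"]) auto
  next
    case (qf_cong P Q)
    then show ?case by (simp add: breakpoints_def)
  qed
  with that show thesis by blast
qed

lemma qf_exists:
  assumes P: "qf_pred B V P" and v: "v \<in> B"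
  shows "qf_pred B (V - {v}) (\<lambda>t e. \<exists>k. P t (e(v := k)))"
proof -
  obtain Pinf D1 where D1: "D1 > 0" and Pinf: "\<And>k. qf_pred B (V - {v}) (Pinf k)"
    and per1: "\<And>k i t e. t \<in> X \<Longrightarrow> Pinf (k + i * D1) t e \<longleftrightarrow> Pinf k t e"
    and lim: "\<And>t e. t \<in> X \<Longrightarrow> \<exists>z. \<forall>k\<le>z. P t (e(v := k)) \<longleftrightarrow> Pinf k t e"
    using qf_near_minus_infinity[OF P v] by metis
  obtain D2 S where D2: "D2 > 0" and finS: "finite S"
    and S: "\<forall>(n, s)\<in>S. n > 0 \<and> affine B (V - {v}) s" and bp2: "breakpoints v D2 S P"
    using qf_breakpoints[OF P v] by metis
  \<comment> \<open>One step length has to be both a period of \<open>Pinf\<close> and a valid step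
    for the breakpoints.\<close>
  define D where "D = D2 * D1"
  have D: "D > 0" using D1 D2 by (simp add: D_def)
  have per: "Pinf (k + i * D) t e \<longleftrightarrow> Pinf k t e" if "t \<in> X" for k i t e
    using per1[OF that, of k "i * D2" e] by (simp add: D_def mult_ac)
  have bp: "breakpoints v D S P"
    unfolding D_def using S by (intro breakpoints_multiple bp2 D1 D2) auto

  \<comment> \<open>For each candidate \<open>(s + j) / n\<close>, a predicate without
    \<open>v\<close> expressing \<open>P\<close> there; these are then chosen as a function
    \<open>Q\<close> of \<open>n\<close>, \<open>s\<close> and \<open>j\<close>.\<close>
  have "\<exists>Q. qf_pred B (V - {v}) Q \<and>
      (\<forall>t\<in>X. \<forall>e k. n * k = s t e + j \<longrightarrow> (Q t e \<longleftrightarrow> P t (e(v := k))))"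
    if "(n, s) \<in> S" for n s j
  proof -
    from that S have "n > 0" "affine B (V - {v}) (\<lambda>t e. s t e + j)"
      by (auto intro: affine_add affine_const)
    from qf_subst_quotient[OF P v this(2,1)] show ?thesis by metis
  qed
  then obtain Q where Q: "\<And>n s j. (n, s) \<in> S \<Longrightarrow> qf_pred B (V - {v}) (Q n s j)"
    and Q_iff: "\<And>n s j t e k. \<lbrakk>(n, s) \<in> S; t \<in> X; n * k = s t e + j\<rbrakk> \<Longrightarrow>
      Q n s j t e \<longleftrightarrow> P t (e(v := k))"
    by metis

  \<comment> \<open>Cooper's finite disjunction. By periodicity the residues modulo \<open>D\<close>
    represent all \<open>k\<close> near minus infinity; the divisibility conjunct says that the
    candidate is an integer, the only case in which \<open>Q\<close> is meaningful.\<close>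
  define E where "E = (\<lambda>t e. (\<exists>k\<in>{0..<D}. Pinf k t e) \<or>
    (\<exists>p\<in>S. \<exists>j\<in>{0..fst p * D}. fst p dvd snd p t e + j \<and> Q (fst p) (snd p) j t e))"
  have "qf_pred B (V - {v}) E"
    unfolding E_def
    using S by (intro qf_disj qf_bex qf_conj qf_dvd affine_add affine_const Pinf Q finS) auto
  moreover have "E t e \<longleftrightarrow> (\<exists>k. P t (e(v := k)))" if t: "t \<in> X" for t e
  proof
    obtain z where z: "\<And>k. k \<le> z \<Longrightarrow> P t (e(v := k)) \<longleftrightarrow> Pinf k t e"
      using lim[OF t] by metis
    have below: "\<exists>i::nat. k - int i * D \<le> z" for k
    proof
      have "int (nat \<bar>k - z\<bar>) * D \<ge> int (nat \<bar>k - z\<bar>) * 1"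
        using D by (intro mult_left_mono) auto
      then show "k - int (nat \<bar>k - z\<bar>) * D \<le> z" by simp
    qed
    {
      assume "E t e"
      then consider k where "Pinf k t e"
        | n s j where "(n, s) \<in> S" "n dvd s t e + j" "Q n s j t e"
        unfolding E_def by auto
      then show "\<exists>k. P t (e(v := k))"
      proof cases
        case 1
        \<comment> \<open>Periodicity carries \<open>Pinf\<close> down to a point below
          \<open>z\<close>, where it agrees with \<open>P\<close>.\<close>
        obtain i :: nat where i: "k - int i * D \<le> z" using below by blast
        have "Pinf (k - int i * D) t e" using per[OF t, of k "- int i" e] 1 by simp
        with z[OF i] show ?thesis by blast
      next
        case 2
        then obtain k where "n * k = s t e + j" by (metis dvd_def)
        with 2 Q_iff t show ?thesis by blast
      qed
    next
      assume "\<exists>k. P t (e(v := k))"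
      then obtain k where k: "P t (e(v := k))" by blast
      show "E t e"
      proof (cases "\<exists>i::nat. P t (e(v := k - int i * D)) \<and> \<not> P t (e(v := k - int i * D - D))")
        case False
        \<comment> \<open>Without a drop from true to false the descent keeps \<open>P\<close> true
          all the way below \<open>z\<close>, so \<open>Pinf\<close> holds there and hence at the
          residue of \<open>k\<close>.\<close>
        have all: "P t (e(v := k - int i * D))" for i :: nat
          using False k by (induction i) (auto simp: algebra_simps)
        obtain i :: nat where i: "k - int i * D \<le> z" using below by blast
        then have "Pinf (k - int i * D) t e" using all z by blast
        then have "Pinf k t e" using per[OF t, of k "- int i" e] by simp
        then have "Pinf (k mod D) t e"
          using per[OF t, of "k mod D" "k div D" e] by (simp add: add.commute)
        then show ?thesis
          unfolding E_def using D by (intro disjI1 bexI[of _ "k mod D"]) auto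
      next
        case True
        then obtain i :: nat where i: "P t (e(v := k - int i * D))"
          "P t (e(v := k - int i * D)) \<noteq> P t (e(v := k - int i * D - D))"
          by blast
        \<comment> \<open>The last point before the drop is itself a candidate, and \<open>P\<close>
          is true at it.\<close>
        then obtain n s j where "(n, s) \<in> S" "j \<in> {0..n * D}"
          "n * (k - int i * D) = s t e + j"
          using bp t unfolding breakpoints_def by fast
        moreover from this have "Q n s j t e"
          using Q_iff t i by blast
        ultimately show ?thesis
          unfolding E_def by (intro disjI2 bexI[of _ "(n, s)"] bexI[of _ j]) (auto intro: dvdI[OF sym])
      qed
    }
  qed
  ultimately show ?thesis by (rule qf_cong)
qed

section \<open>Passing between formulas and predicates\<close>

lemma affine_eval_term:
  assumes "coeffs s \<subseteq> R" "term_coeffs_ok X B s"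
  shows "affine B (rterm_vars s) (\<lambda>t e. eval_pterm e (inst_term t s))"
  using assms
proof (induction s)
  case (RVar w)
  show ?case using affine_monomial[OF coeff_const[of 1] _ is_constant_const] by simp
next
  case (RAdd s1 s2)
  then have "affine B (rterm_vars s1 \<union> rterm_vars s2) (\<lambda>t e. eval_pterm e (inst_term t s1))"
    "affine B (rterm_vars s1 \<union> rterm_vars s2) (\<lambda>t e. eval_pterm e (inst_term t s2))"
    by (auto intro: affine_mono)
  then show ?case by (simp add: affine_add)
next
  case (Scale \<alpha> s)
  \<comment> \<open>\<open>term_coeffs_ok\<close> says that \<open>\<alpha>\<close> is constant or
    that \<open>s\<close> has no variable in \<open>B\<close>, which is the alternative
    \<open>affine_scale\<close> asks for.\<close>
  then have "affine B (rterm_vars s) (\<lambda>t e. \<alpha> t * eval_pterm e (inst_term t s))"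
    by (intro affine_scale coeff_ring_member) auto
  then show ?case by (simp only: eval_inst_scale rterm_vars.simps)
qed (auto simp: affine_const affine_minus)

lemma qf_less:
  assumes "affine B V g" "affine B V h"
  shows "qf_pred B V (\<lambda>t e. g t e < h t e)"
  using qf_pos[OF affine_diff[OF assms(2,1)]] by simp

lemma qf_eq:
  assumes "affine B V g" "affine B V h"
  shows "qf_pred B V (\<lambda>t e. g t e = h t e)"
  by (rule qf_cong[OF qf_conj[OF qf_not[OF qf_less[OF assms]] qf_not[OF qf_less[OF assms(2,1)]]]])
    auto

text \<open>Induction with \<open>B\<close> arbitrary: below a quantifier the hypothesis is used for
  \<open>insert v B\<close>, the set tracked by \<open>fm_coeffs_ok\<close>, so that
  \<open>v\<close> can be eliminated. Afterwards \<open>qf_mono\<close> returns to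
  \<open>B\<close>.\<close>

lemma qf_formula:
  assumes "is_LR_formula R \<phi>" "constant_divisors X \<phi>" "fm_coeffs_ok X B \<phi>"
  shows "qf_pred B (free_vars \<phi>) (\<lambda>t e. holds e (inst_fm t \<phi>))"
  using assms
proof (induction \<phi> arbitrary: B)
  case (Eq s1 s2)
  then have "affine B (rterm_vars s1 \<union> rterm_vars s2) (\<lambda>t e. eval_pterm e (inst_term t s1))"
    "affine B (rterm_vars s1 \<union> rterm_vars s2) (\<lambda>t e. eval_pterm e (inst_term t s2))"
    by (auto simp: is_LR_formula_def intro: affine_mono[OF affine_eval_term])
  then show ?case by (simp add: inst_fm_def qf_eq)
next
  case (Less s1 s2)
  then have "affine B (rterm_vars s1 \<union> rterm_vars s2) (\<lambda>t e. eval_pterm e (inst_term t s1))"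
    "affine B (rterm_vars s1 \<union> rterm_vars s2) (\<lambda>t e. eval_pterm e (inst_term t s2))"
    by (auto simp: is_LR_formula_def intro: affine_mono[OF affine_eval_term])
  then show ?case by (simp add: inst_fm_def qf_less)
next
  case (Dvd \<alpha> s)
  then obtain c where c: "\<forall>t\<in>X. \<alpha> t = c"
    by (auto simp: constant_divisors_def is_constant_def)
  have s: "affine B (rterm_vars s) (\<lambda>t e. eval_pterm e (inst_term t s))"
    using Dvd by (auto simp: is_LR_formula_def intro: affine_eval_term)
  show ?case
  \<comment> \<open>The predicate for divisor 0 is false by convention, unlike
    \<open>0 dvd x\<close>; a negative \<open>c\<close> acts through its absolute value.\<close>
  proof (cases "c = 0")
    case True
    with c show ?thesis by (intro qf_cong[OF qf_const[of _ _ False]]) (simp add: inst_fm_def)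
  next
    case False
    then have "qf_pred B (rterm_vars s) (\<lambda>t e. \<bar>c\<bar> dvd eval_pterm e (inst_term t s))"
      by (intro qf_dvd s) simp
    with c False show ?thesis by (auto intro: qf_cong simp: inst_fm_def)
  qed
next
  case (Neg \<phi>)
  then show ?case
    by (simp add: inst_fm_def is_LR_formula_def constant_divisors_def qf_not)
next
  case (Conj \<phi> \<psi>)
  have "qf_pred B (free_vars \<phi> \<union> free_vars \<psi>) (\<lambda>t e. holds e (inst_fm t \<phi>))"
    "qf_pred B (free_vars \<phi> \<union> free_vars \<psi>) (\<lambda>t e. holds e (inst_fm t \<psi>))"
    using Conj.prems
    by (auto simp: is_LR_formula_def constant_divisors_def
        intro!: qf_mono[OF Conj.IH(1)[of B]] qf_mono[OF Conj.IH(2)[of B]])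
  then show ?case by (simp add: inst_fm_def qf_conj)
next
  case (Disj \<phi> \<psi>)
  have "qf_pred B (free_vars \<phi> \<union> free_vars \<psi>) (\<lambda>t e. holds e (inst_fm t \<phi>))"
    "qf_pred B (free_vars \<phi> \<union> free_vars \<psi>) (\<lambda>t e. holds e (inst_fm t \<psi>))"
    using Disj.prems
    by (auto simp: is_LR_formula_def constant_divisors_def
        intro!: qf_mono[OF Disj.IH(1)[of B]] qf_mono[OF Disj.IH(2)[of B]])
  then show ?case by (simp add: inst_fm_def qf_disj)
next
  case (Imp \<phi> \<psi>)
  have "qf_pred B (free_vars \<phi> \<union> free_vars \<psi>) (\<lambda>t e. holds e (inst_fm t \<phi>))"
    "qf_pred B (free_vars \<phi> \<union> free_vars \<psi>) (\<lambda>t e. holds e (inst_fm t \<psi>))"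
    using Imp.prems
    by (auto simp: is_LR_formula_def constant_divisors_def
        intro!: qf_mono[OF Imp.IH(1)[of B]] qf_mono[OF Imp.IH(2)[of B]])
  then show ?case by (simp add: inst_fm_def qf_imp)
next
  case (Iff \<phi> \<psi>)
  have "qf_pred B (free_vars \<phi> \<union> free_vars \<psi>) (\<lambda>t e. holds e (inst_fm t \<phi>))"
    "qf_pred B (free_vars \<phi> \<union> free_vars \<psi>) (\<lambda>t e. holds e (inst_fm t \<psi>))"
    using Iff.prems
    by (auto simp: is_LR_formula_def constant_divisors_def
        intro!: qf_mono[OF Iff.IH(1)[of B]] qf_mono[OF Iff.IH(2)[of B]])
  then show ?case
    using qf_conj[OF qf_imp qf_imp] by (simp add: inst_fm_def iff_conv_conj_imp)
next
  case (Exists v \<phi>)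
  then have "qf_pred (insert v B) (free_vars \<phi>) (\<lambda>t e. holds e (inst_fm t \<phi>))"
    by (simp add: is_LR_formula_def constant_divisors_def)
  from qf_mono[OF qf_exists[OF this, of v]] show ?case
    by (auto simp: inst_fm_def)
next
  case (Forall v \<phi>)
  \<comment> \<open>The universal quantifier is treated as the negation of an existential
    one.\<close>
  then have "qf_pred (insert v B) (free_vars \<phi>) (\<lambda>t e. \<not> holds e (inst_fm t \<phi>))"
    by (simp add: is_LR_formula_def constant_divisors_def qf_not)
  from qf_not[OF qf_mono[OF qf_exists[OF this, of v], of B]] show ?case
    by (auto simp: inst_fm_def)
qed

section \<open>Realising predicates by formulas\<close>

lemma affine_term_exists:
  assumes "affine B V g"
  shows "\<exists>s. coeffs s \<subseteq> R \<and> rterm_vars s \<subseteq> V \<and>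
    (\<forall>t\<in>X. \<forall>e. eval_pterm e (inst_term t s) = g t e)"
  using assms
proof (induction rule: affine.induct)
  case (affine_coeff \<alpha>)
  \<comment> \<open>The coefficient \<open>\<alpha>\<close> becomes the term
    \<open>\<alpha> \<cdot> 1\<close>, restricted to \<open>X\<close> so that it belongs to
    \<open>R\<close>.\<close>
  then show ?case
    by (intro exI[of _ "Scale (restrict \<alpha> X) ROne"])
      (simp add: coeff_def eval_inst_scale del: inst_term.simps(6))
next
  case (affine_monomial \<alpha> v)
  then show ?case
    by (intro exI[of _ "Scale (restrict \<alpha> X) (RVar v)"])
      (simp add: coeff_def eval_inst_scale del: inst_term.simps(6))
next
  case (affine_add g h)
  then obtain s1 s2 where
    "coeffs s1 \<subseteq> R \<and> rterm_vars s1 \<subseteq> V \<and> (\<forall>t\<in>X. \<forall>e. eval_pterm e (inst_term t s1) = g t e)"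
    "coeffs s2 \<subseteq> R \<and> rterm_vars s2 \<subseteq> V \<and> (\<forall>t\<in>X. \<forall>e. eval_pterm e (inst_term t s2) = h t e)"
    by blast
  then show ?case by (intro exI[of _ "RAdd s1 s2"]) simp
qed

lemma qf_formula_exists:
  assumes "qf_pred B V P"
  shows "\<exists>\<psi>. is_LR_formula R \<psi> \<and> free_vars \<psi> \<subseteq> V \<and> quantifier_free \<psi> \<and>
    constant_divisors X \<psi> \<and> (\<forall>t\<in>X. \<forall>e. holds e (inst_fm t \<psi>) \<longleftrightarrow> P t e)"
  using assms
proof (induction rule: qf_pred.induct)
  case (qf_pos g)
  then obtain s where "coeffs s \<subseteq> R" "rterm_vars s \<subseteq> V"
    "\<forall>t\<in>X. \<forall>e. eval_pterm e (inst_term t s) = g t e"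
    using affine_term_exists by blast
  then show ?case
    by (intro exI[of _ "Less RZero s"])
      (simp add: is_LR_formula_def constant_divisors_def inst_fm_def)
next
  case (qf_dvd g m)
  then obtain s where "coeffs s \<subseteq> R" "rterm_vars s \<subseteq> V"
    "\<forall>t\<in>X. \<forall>e. eval_pterm e (inst_term t s) = g t e"
    using affine_term_exists by blast
  \<comment> \<open>Taking the constant function \<open>m\<close> as divisor index secures condition
    (1) for the new formula.\<close>
  then show ?case
    using qf_dvd(2) const_in_ring
    by (intro exI[of _ "Dvd (const_fun X m) s"])
      (auto simp: is_LR_formula_def constant_divisors_def inst_fm_def const_fun_def is_constant_def)
next
  case (qf_not P)
  then obtain \<psi> where "is_LR_formula R \<psi> \<and> free_vars \<psi> \<subseteq> V \<and> quantifier_free \<psi> \<and>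
    constant_divisors X \<psi> \<and> (\<forall>t\<in>X. \<forall>e. holds e (inst_fm t \<psi>) \<longleftrightarrow> P t e)"
    by blast
  then show ?case
    by (intro exI[of _ "Neg \<psi>"]) (simp add: is_LR_formula_def constant_divisors_def inst_fm_def)
next
  case (qf_conj P Q)
  then obtain \<psi> \<chi> where
    "is_LR_formula R \<psi> \<and> free_vars \<psi> \<subseteq> V \<and> quantifier_free \<psi> \<and>
      constant_divisors X \<psi> \<and> (\<forall>t\<in>X. \<forall>e. holds e (inst_fm t \<psi>) \<longleftrightarrow> P t e)"
    "is_LR_formula R \<chi> \<and> free_vars \<chi> \<subseteq> V \<and> quantifier_free \<chi> \<and>
      constant_divisors X \<chi> \<and> (\<forall>t\<in>X. \<forall>e. holds e (inst_fm t \<chi>) \<longleftrightarrow> Q t e)"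
    by blast
  then show ?case
    by (intro exI[of _ "Conj \<psi> \<chi>"])
      (auto simp: is_LR_formula_def constant_divisors_def inst_fm_def)
next
  case (qf_cong P Q)
  then show ?case by simp
qed

end

theorem theorem1p5:
  fixes X :: "'x set" and R :: "('x \<Rightarrow> int) set"
    and \<phi> :: "'x ring_fm" and xs :: "nat list"
  assumes "X \<noteq> {}"
    and "function_ring X R"
    and "\<And>c. const_fun X c \<in> R"
    and "is_LR_formula R \<phi>"
    and "distinct xs" and "free_vars \<phi> \<subseteq> set xs"
    and "constant_divisors X \<phi>"
    and "bound_coeffs_constant X \<phi>"
  shows "\<exists>\<psi> :: 'x ring_fm.
           is_LR_formula R \<psi> \<and> free_vars \<psi> \<subseteq> set xs \<and>
           quantifier_free \<psi> \<and> constant_divisors X \<psi> \<and>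
           logically_equivalent X \<phi> \<psi>"
proof -
  interpret integer_function_ring X R
    using assms(2,3) by unfold_locales
  \<comment> \<open>At the outermost level no variable is bound, so free variables may carry
    arbitrary coefficients from \<open>R\<close>.\<close>
  have "qf_pred {} (free_vars \<phi>) (\<lambda>t e. holds e (inst_fm t \<phi>))"
    using assms by (intro qf_formula) (simp_all add: bound_coeffs_constant_def)
  from qf_formula_exists[OF this] assms(6) show ?thesis
    unfolding logically_equivalent_def by blast
qed

end
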